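(* If $G$ and $H$ are nontrivial connected graphs, then $pc_{1,2}(G\vee H)\leq 3$.
   Context: All graphs are finite, undirected and simple; a graph is nontrivial if it has at least two vertices. The join $G\vee H$ of two (vertex-disjoint) graphs has vertex set $V(G)\cup V(H)$ and edge set $E(G)\cup E(H)\cup\{uv: u\in V(G),\ v\in V(H)\}$. An edge-coloring of a graph is an arbitrary map from its edge set to the natural numbers (adjacent edges may share a color). In an edge-colored graph, a path $P$ is a distance $2$-proper path if no two edges of $P$ of the same color appear with fewer than $2$ edges in between on $P$. For a connected graph $F$, $pc_{1,2}(F)$ is the minimum number of colors in an edge-coloring of $F$ such that every pair of distinct vertices of $F$ is connected by at least one distance $2$-proper path. *)

theory Defs
  imports "Graph_Theory.Graph_Theory"
begin

text \<open>
  Finite simple undirected graphs are represented by \<open>pair_graph\<close>: finite, loop-free digraphs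
  without parallel arcs whose arc relation is symmetric. An undirected edge \<open>{u, v}\<close> is thus
  represented by the two arcs \<open>(u, v)\<close> and \<open>(v, u)\<close>. Colors are attached to
  undirected edges, so both arcs always carry the same color.
\<close>

definition edge_of :: "'a \<times> 'a \<Rightarrow> 'a set" where
  "edge_of e = {fst e, snd e}"

definition edges :: "'a pair_pre_digraph \<Rightarrow> 'a set set" where
  "edges G = edge_of ` parcs G"

definition nontrivial :: "'a pair_pre_digraph \<Rightarrow> bool" where
  "nontrivial G \<longleftrightarrow> 2 \<le> card (pverts G)"

definition graph_join :: "'a pair_pre_digraph \<Rightarrow> 'a pair_pre_digraph \<Rightarrow> 'a pair_pre_digraph" where
  "graph_join G H = \<lparr> pverts = pverts G \<union> pverts H,
     parcs = parcs G \<union> parcs H \<union> pverts G \<times> pverts H \<union> pverts H \<times> pverts G \<rparr>"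

text \<open>
  A path is given by its list of consecutive arcs; between the arcs at positions \<open>i < j\<close> lie
  exactly \<open>j - i - 1\<close> edges.
\<close>

definition distance2_proper :: "('a set \<Rightarrow> nat) \<Rightarrow> ('a \<times> 'a) list \<Rightarrow> bool" where
  "distance2_proper c p \<longleftrightarrow>
     (\<forall>i j. i < j \<and> j < length p \<and> j - i - 1 < 2 \<longrightarrow> c (edge_of (p ! i)) \<noteq> c (edge_of (p ! j)))"

definition distance2_proper_connected :: "'a pair_pre_digraph \<Rightarrow> ('a set \<Rightarrow> nat) \<Rightarrow> bool" where
  "distance2_proper_connected F c \<longleftrightarrow>
     (\<forall>u \<in> pverts F. \<forall>v \<in> pverts F. u \<noteq> v \<longrightarrow>
        (\<exists>p. pre_digraph.apath (with_proj F) u p v \<and> distance2_proper c p))"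

text \<open>
  The coloring \<open>c\<close> is a total function on vertex sets, but only its values on the edges count.
  For connected \<open>F\<close> the minimum is attained, see \<open>pc12_attained\<close> below.
\<close>

definition pc12 :: "'a pair_pre_digraph \<Rightarrow> nat" where
  "pc12 F = (LEAST k. \<exists>c. distance2_proper_connected F c \<and> card (c ` edges F) = k)"

lemma apath_distinct_edges:
  assumes "pair_graph F" "pre_digraph.apath (with_proj F) u p v"
  shows "distinct (map edge_of p)"
  using assms(2)
proof (induction p arbitrary: u)
  case Nil
  then show ?case by simp
next
  case (Cons e p)
  interpret pair_graph F by fact
  have e: "fst e = u" and rest: "apath (snd e) p v" and u: "u \<notin> set (pawalk_verts (snd e) p)"
    using Cons.prems by (auto simp: apath_Cons_iff)
  have "fst f \<in> set (pawalk_verts (snd e) p)" "snd f \<in> set (pawalk_verts (snd e) p)"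
    if "f \<in> set p" for f
  proof -
    have "set (pawalk_verts (snd e) p) = {snd e} \<union> set (map fst p) \<union> set (map snd p)"
      using rest awalk_verts_conv'[of "snd e" p v] set_awalk_verts[of "snd e" p v]
      by (auto simp: apath_def awalk_def)
    then show "fst f \<in> set (pawalk_verts (snd e) p)" "snd f \<in> set (pawalk_verts (snd e) p)"
      using that by auto
  qed
  then have "edge_of e \<noteq> edge_of f" if "f \<in> set p" for f
    using that u e by (fastforce simp: edge_of_def doubleton_eq_iff)
  then show ?case
    using Cons.IH[of "snd e"] rest by auto
qed

lemma distance2_proper_connected_exists:
  assumes "pair_graph F" "connected (with_proj F)"
  shows "\<exists>c. distance2_proper_connected F c"
proof -
  interpret pair_graph F by fact
  have fin: "finite (edges F)"
    by (simp add: edges_def pair_finite_arcs)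
  then obtain c :: "'a set \<Rightarrow> nat" where c: "inj_on c (edges F)"
    using finite_imp_inj_to_nat_seg by blast
  have "\<exists>p. apath u p v \<and> distance2_proper c p" if uv: "u \<in> pverts F" "v \<in> pverts F" for u v
  proof -
    have "strongly_connected (with_proj F)"
      using assms(2) symmetric_connected_imp_strongly_connected pair_sym_arcs by blast
    then have "u \<rightarrow>\<^sup>*\<^bsub>with_proj F\<^esub> v"
      using uv by (auto simp: strongly_connected_def)
    then obtain p where p: "apath u p v"
      using reachable_apath by blast
    then have sub: "set p \<subseteq> parcs F"
      by (auto simp: apath_def awalk_def)
    have d: "distinct (map edge_of p)"
      using apath_distinct_edges[OF assms(1)] p by blast
    have "distance2_proper c p"
      unfolding distance2_proper_def
    proof (intro allI impI)
      fix i j assume ij: "i < j \<and> j < length p \<and> j - i - 1 < 2"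
      then have "edge_of (p ! i) \<noteq> edge_of (p ! j)"
        using d by (auto simp: distinct_conv_nth)
      moreover have "edge_of (p ! i) \<in> edges F" "edge_of (p ! j) \<in> edges F"
        using ij sub nth_mem[of i p] nth_mem[of j p] by (auto simp: edges_def simp del: nth_mem)
      ultimately show "c (edge_of (p ! i)) \<noteq> c (edge_of (p ! j))"
        using c by (auto dest: inj_onD)
    qed
    with p show ?thesis by blast
  qed
  then show ?thesis
    unfolding distance2_proper_connected_def by blast
qed

lemma pc12_attained:
  assumes "pair_graph F" "connected (with_proj F)"
  shows "\<exists>c. distance2_proper_connected F c \<and> card (c ` edges F) = pc12 F"
  unfolding pc12_def
  by (rule LeastI_ex) (use distance2_proper_connected_exists[OF assms] in blast)

lemma pair_graph_join:
  assumes "pair_graph G" "pair_graph H" "pverts G \<inter> pverts H = {}"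
  shows "pair_graph (graph_join G H)"
proof -
  interpret G: pair_graph G by fact
  interpret H: pair_graph H by fact
  show ?thesis
    using G.pair_finite_verts H.pair_finite_verts G.pair_finite_arcs H.pair_finite_arcs
      G.arcs_symmetric H.arcs_symmetric G.pair_no_loops H.pair_no_loops assms(3)
      G.wellformed' H.wellformed'
    by unfold_locales (auto simp: graph_join_def symmetric_def sym_def)
qed

lemma connected_graph_join:
  assumes "pair_graph G" "pair_graph H" "pverts G \<inter> pverts H = {}"
    "pverts G \<noteq> {}" "pverts H \<noteq> {}"
  shows "connected (with_proj (graph_join G H))"
proof -
  interpret J: pair_graph "graph_join G H" using pair_graph_join assms by blast
  obtain g h where gh: "g \<in> pverts G" "h \<in> pverts H" using assms(4,5) by blast
  let ?J = "with_proj (graph_join G H)"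
  have g: "u \<rightarrow>\<^sup>*\<^bsub>?J\<^esub> g \<and> g \<rightarrow>\<^sup>*\<^bsub>?J\<^esub> u" if "u \<in> pverts G \<union> pverts H" for u
  proof -
    have gh': "g \<rightarrow>\<^sup>*\<^bsub>?J\<^esub> h"
      using gh by (intro J.reachable_adjI) (auto simp: graph_join_def)
    have "u \<rightarrow>\<^sup>*\<^bsub>?J\<^esub> g"
    proof (cases "u \<in> pverts G")
      case True
      then have "u \<rightarrow>\<^sup>*\<^bsub>?J\<^esub> h"
        using gh by (intro J.reachable_adjI) (auto simp: graph_join_def)
      then show ?thesis
        using gh' J.symmetric_reachable' J.reachable_trans by blast
    next
      case False
      then show ?thesis
        using gh that by (intro J.reachable_adjI) (auto simp: graph_join_def)
    qed
    then show ?thesis using J.symmetric_reachable' by blast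
  qed
  have "strongly_connected ?J"
  proof (rule strongly_connectedI)
    show "verts ?J \<noteq> {}" using gh by (auto simp: graph_join_def)
    fix u v assume "u \<in> verts ?J" "v \<in> verts ?J"
    then show "u \<rightarrow>\<^sup>*\<^bsub>?J\<^esub> v"
      using g[of u] g[of v] J.reachable_trans[of u g v] by (auto simp: graph_join_def)
  qed
  moreover have "(u, v) \<in> rtrancl_on (verts ?J) ((arcs_ends ?J)\<^sup>s)" if "u \<rightarrow>\<^sup>*\<^bsub>?J\<^esub> v" for u v
    using that rtrancl_on_mono[of "arcs_ends ?J" "(arcs_ends ?J)\<^sup>s" "verts ?J" "verts ?J"]
    unfolding reachable_def symcl_def by blast
  ultimately show ?thesis
    unfolding connected_conv strongly_connected_def by blast
qed

end

theory Submission
  imports Defs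
begin

text \<open>
  Split each factor into a maximal independent set and its complement, \<open>V(G) = A \<union> B\<close> and
  \<open>V(H) = C \<union> D\<close>; as there are no isolated vertices, every vertex has a neighbor in the other
  part of its factor. Give color 0 to the edges inside the factors, color 2 to the \<open>A\<close>-\<open>C\<close> edges
  and color 1 to all other edges between the factors. Vertices \<open>a \<in> A\<close>, \<open>b \<in> B\<close> are joined through any
  \<open>x \<in> C\<close>, and distinct \<open>u, v\<close> in the same part of \<open>G\<close> by a path \<open>u, w, x, v\<close> where \<open>w\<close> is
  a neighbor of \<open>u\<close> in the other part. The coloring is symmetric in the two factors.
\<close>

lemma pverts_graph_join: "pverts (graph_join G H) = pverts G \<union> pverts H"
  and parcs_graph_join: "parcs (graph_join G H) =
    parcs G \<union> parcs H \<union> pverts G \<times> pverts H \<union> pverts H \<times> pverts G"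
  by (simp_all add: graph_join_def)

lemma graph_join_commute: "graph_join G H = graph_join H G"
  by (auto simp: graph_join_def)

lemma (in pair_graph) connected_imp_neighbor:
  assumes "connected (with_proj G)" "nontrivial G" "u \<in> pverts G"
  shows "\<exists>w. (u, w) \<in> parcs G"
proof -
  obtain v where v: "v \<in> pverts G" "v \<noteq> u"
    using assms(2) card_le_Suc0_iff_eq[OF pair_finite_verts] assms(3)
    unfolding nontrivial_def by (metis not_less_eq_eq numeral_2_eq_2)
  have "strongly_connected (with_proj G)"
    using assms(1) symmetric_connected_imp_strongly_connected pair_sym_arcs by blast
  then have "u \<rightarrow>\<^sup>*\<^bsub>with_proj G\<^esub> v"
    using v assms(3) by (auto simp: strongly_connected_def)
  \<comment> \<open>As \<open>v\<close> differs from \<open>u\<close>, a walk reaching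
    \<open>v\<close> must leave \<open>u\<close> by a first arc.\<close>
  then show ?thesis
    using v(2) by (cases rule: converse_reachable_cases) auto
qed

text \<open>Take a maximal independent set \<open>A\<close>. A vertex in \<open>A\<close> has some
  neighbor by assumption, which independence puts outside \<open>A\<close>; a vertex outside
  \<open>A\<close> has a neighbor in it by maximality.\<close>

lemma (in pair_graph) dominating_bipartition_exists:
  assumes "\<And>u. u \<in> pverts G \<Longrightarrow> \<exists>w. (u, w) \<in> parcs G"
  shows "\<exists>A \<subseteq> pverts G. \<forall>u \<in> pverts G. \<exists>w. (u, w) \<in> parcs G \<and> (w \<in> A \<longleftrightarrow> u \<notin> A)"
proof -
  define I where "I = {A. A \<subseteq> pverts G \<and> (\<forall>u \<in> A. \<forall>w \<in> A. (u, w) \<notin> parcs G)}"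
  have "finite I"
    by (rule finite_subset[of _ "Pow (pverts G)"]) (auto simp: I_def)
  moreover have "{} \<in> I" by (simp add: I_def)
  ultimately obtain A where A: "A \<in> I" and max: "\<And>A'. A' \<in> I \<Longrightarrow> A \<subseteq> A' \<Longrightarrow> A = A'"
    using finite_has_maximal2[of I "{}"] by auto
  have "\<exists>w. (u, w) \<in> parcs G \<and> (w \<in> A \<longleftrightarrow> u \<notin> A)" if u: "u \<in> pverts G" for u
  proof (cases "u \<in> A")
    case True
    then show ?thesis using A assms[OF u] by (auto simp: I_def)
  next
    case False
    \<comment> \<open>The arc that violates independence is neither a loop nor inside
      \<open>A\<close>, so it joins \<open>u\<close> to \<open>A\<close>; symmetry orients it away
      from \<open>u\<close>.\<close>
    then have "insert u A \<notin> I" using max by blast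
    then show ?thesis
      using A u False arcs_symmetric pair_no_loops by (fastforce simp: I_def)
  qed
  then show ?thesis using A by (auto simp: I_def)
qed

text \<open>\<open>V\<close> and \<open>W\<close> stand for the vertex sets of the factors,
  \<open>A\<close> and \<open>C\<close> for their chosen parts. Once the first test fails, an edge
  of the join runs between the factors, so the second test singles out the
  \<open>A\<close>-\<open>C\<close> edges.\<close>

definition join_coloring :: "'a set \<Rightarrow> 'a set \<Rightarrow> 'a set \<Rightarrow> 'a set \<Rightarrow> 'a set \<Rightarrow> nat" where
  "join_coloring V W A C e =
     (if e \<subseteq> V \<or> e \<subseteq> W then 0 else if e \<subseteq> A \<union> C then 2 else 1)"

lemma join_coloring_commute: "join_coloring V W A C = join_coloring W V C A"
  by (auto simp: join_coloring_def fun_eq_iff)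

text \<open>Arcs with fewer than 2 edges in between are at most two positions apart, so a new first
  arc competes only with the next two. This lets simplification check explicit arc lists.\<close>

lemma distance2_proper_Cons:
  "distance2_proper c (e # p) \<longleftrightarrow>
     (\<forall>f \<in> set (take 2 p). c (edge_of e) \<noteq> c (edge_of f)) \<and> distance2_proper c p"
proof
  assume *: "distance2_proper c (e # p)"
  have "c (edge_of e) \<noteq> c (edge_of f)" if f: "f \<in> set (take 2 p)" for f
  proof -
    obtain k where k: "k < length p" "k < 2" "f = p ! k"
      using f by (auto simp: in_set_conv_nth)
    show ?thesis
      using *[unfolded distance2_proper_def, rule_format, of 0 "Suc k"] k by simp
  qed
  moreover have "distance2_proper c p"
    unfolding distance2_proper_def
  proof (intro allI impI)
    fix i j assume "i < j \<and> j < length p \<and> j - i - 1 < 2"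
    then show "c (edge_of (p ! i)) \<noteq> c (edge_of (p ! j))"
      using *[unfolded distance2_proper_def, rule_format, of "Suc i" "Suc j"] by simp
  qed
  ultimately show "(\<forall>f \<in> set (take 2 p). c (edge_of e) \<noteq> c (edge_of f)) \<and> distance2_proper c p"
    by blast
next
  assume *: "(\<forall>f \<in> set (take 2 p). c (edge_of e) \<noteq> c (edge_of f)) \<and> distance2_proper c p"
  show "distance2_proper c (e # p)"
    unfolding distance2_proper_def
  proof (intro allI impI)
    fix i j assume ij: "i < j \<and> j < length (e # p) \<and> j - i - 1 < 2"
    then obtain k where k: "j = Suc k" by (cases j) auto
    show "c (edge_of ((e # p) ! i)) \<noteq> c (edge_of ((e # p) ! j))"
    proof (cases i)
      case 0
      then have "p ! k \<in> set (take 2 p)"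
        using ij k by (auto simp: in_set_conv_nth intro!: exI[of _ k])
      then show ?thesis using * 0 k by simp
    next
      case (Suc m)
      then show ?thesis
        using * ij k by (simp add: distance2_proper_def)
    qed
  qed
qed

lemma distance2_proper_Nil: "distance2_proper c []"
  by (simp add: distance2_proper_def)

lemma join_coloring_factor_edge:
  assumes "u \<in> V" "w \<in> V"
  shows "join_coloring V W A C (edge_of (u, w)) = 0"
  using assms by (simp add: join_coloring_def edge_of_def)

text \<open>With one end fixed in \<open>C\<close>, the color tells whether the other end is in
  \<open>A\<close>. Hence two cross edges at \<open>x\<close> differ in color when their other ends
  are on opposite sides.\<close>

lemma join_coloring_cross_edge:
  assumes "V \<inter> W = {}" "C \<subseteq> W" "u \<in> V" "x \<in> C"
  shows "join_coloring V W A C (edge_of (u, x)) = (if u \<in> A then 2 else 1)"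
    and "join_coloring V W A C (edge_of (x, u)) = (if u \<in> A then 2 else 1)"
  using assms by (auto simp: join_coloring_def edge_of_def)

lemma join_coloring_connects_factor:
  assumes G: "pair_graph G" and H: "pair_graph H" and disj: "pverts G \<inter> pverts H = {}"
    and nb: "\<forall>u \<in> pverts G. \<exists>w. (u, w) \<in> parcs G \<and> (w \<in> A \<longleftrightarrow> u \<notin> A)"
    and C: "C \<subseteq> pverts H" "x \<in> C"
    and uv: "u \<in> pverts G" "v \<in> pverts G" "u \<noteq> v"
  shows "\<exists>p. pre_digraph.apath (with_proj (graph_join G H)) u p v \<and>
             distance2_proper (join_coloring (pverts G) (pverts H) A C) p"
proof -
  interpret G: pair_graph G by fact
  interpret J: pair_graph "graph_join G H"
    using pair_graph_join G H disj by blast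
  have x: "x \<in> pverts H" "x \<notin> pverts G" using C disj by auto
  show ?thesis
  proof (cases "u \<in> A \<longleftrightarrow> v \<in> A")
    case False
    have "J.apath u [(u, x), (x, v)] v"
      using uv x by (auto simp: J.apath_Cons_iff J.apath_Nil_iff pverts_graph_join parcs_graph_join)
    moreover have "distance2_proper (join_coloring (pverts G) (pverts H) A C) [(u, x), (x, v)]"
      using uv False join_coloring_cross_edge[OF disj C(1) _ C(2)]
      by (simp add: distance2_proper_Cons distance2_proper_Nil)
    ultimately show ?thesis by blast
  next
    case True
    obtain w where w: "(u, w) \<in> parcs G" "w \<in> A \<longleftrightarrow> u \<notin> A" using nb uv by blast
    have w': "w \<in> pverts G" "w \<noteq> u" "w \<noteq> v"
      using w G.wellformed' True by auto
    have "J.apath u [(u, w), (w, x), (x, v)] v"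
      using uv x w w' by (auto simp: J.apath_Cons_iff J.apath_Nil_iff pverts_graph_join parcs_graph_join)
    \<comment> \<open>The colors are 0, then 1 and 2 in some order, because \<open>w\<close> is on
      the side opposite to \<open>u\<close> and hence to \<open>v\<close>.\<close>
    moreover have "distance2_proper (join_coloring (pverts G) (pverts H) A C)
        [(u, w), (w, x), (x, v)]"
      using uv True w(2) w'(1) join_coloring_cross_edge[OF disj C(1) _ C(2)]
      by (simp add: distance2_proper_Cons distance2_proper_Nil join_coloring_factor_edge)
    ultimately show ?thesis by blast
  qed
qed

theorem theorem4p1:
  fixes G H :: "'a pair_pre_digraph"
  assumes "pair_graph G" and "pair_graph H"
    and "pverts G \<inter> pverts H = {}"
    and "nontrivial G" and "nontrivial H"
    and "connected (with_proj G)" and "connected (with_proj H)"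
  shows "pc12 (graph_join G H) \<le> 3"
proof -
  interpret G: pair_graph G by fact
  interpret H: pair_graph H by fact
  interpret J: pair_graph "graph_join G H"
    using pair_graph_join assms(1-3) by blast
  obtain A where A: "A \<subseteq> pverts G"
      "\<forall>u \<in> pverts G. \<exists>w. (u, w) \<in> parcs G \<and> (w \<in> A \<longleftrightarrow> u \<notin> A)"
    using G.dominating_bipartition_exists G.connected_imp_neighbor assms(4,6) by metis
  obtain C where C: "C \<subseteq> pverts H"
      "\<forall>u \<in> pverts H. \<exists>w. (u, w) \<in> parcs H \<and> (w \<in> C \<longleftrightarrow> u \<notin> C)"
    using H.dominating_bipartition_exists H.connected_imp_neighbor assms(5,7) by metis
  have "pverts G \<noteq> {}" "pverts H \<noteq> {}"
    using assms(4,5) by (auto simp: nontrivial_def)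
  \<comment> \<open>A vertex of \<open>G\<close> lies in \<open>A\<close> or has a neighbor there;
    likewise for \<open>H\<close> and \<open>C\<close>.\<close>
  then obtain a x where ax: "a \<in> A" "x \<in> C"
    using A(2) C(2) by blast
  define c where "c = join_coloring (pverts G) (pverts H) A C"
  have "distance2_proper_connected (graph_join G H) c"
    unfolding distance2_proper_connected_def
  proof (intro ballI impI)
    fix u v
    assume "u \<in> pverts (graph_join G H)" "v \<in> pverts (graph_join G H)" and neq: "u \<noteq> v"
    then consider "u \<in> pverts G" "v \<in> pverts G" | "u \<in> pverts H" "v \<in> pverts H"
      | "(u, v) \<in> parcs (graph_join G H)"
      by (auto simp: pverts_graph_join parcs_graph_join)
    then show "\<exists>p. J.apath u p v \<and> distance2_proper c p"
    proof cases
      case 1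
      then show ?thesis
        unfolding c_def
        using join_coloring_connects_factor[OF assms(1-3) A(2) C(1) ax(2)] neq by blast
    next
      case 2
      have "pverts H \<inter> pverts G = {}" using assms(3) by blast
      then show ?thesis
        \<comment> \<open>The factors swap roles. Fixing the first argument directs both
          commutativity rules so that \<open>H\<close> comes first.\<close>
        unfolding c_def graph_join_commute[of G] join_coloring_commute[of "pverts G"]
        using join_coloring_connects_factor[OF assms(2,1) _ C(2) A(1) ax(1)] 2 neq by blast
    next
      case 3
      then have "J.apath u [(u, v)] v"
        using neq J.wellformed' by (auto simp: J.apath_Cons_iff J.apath_Nil_iff)
      moreover have "distance2_proper c [(u, v)]" by (simp add: distance2_proper_Cons distance2_proper_Nil)
      ultimately show ?thesis by blast
    qed
  qed
  then have "pc12 (graph_join G H) \<le> card (c ` edges (graph_join G H))"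
    unfolding pc12_def by (intro Least_le) blast
  also have "\<dots> \<le> card {0, 1, 2 :: nat}"
    by (intro card_mono) (auto simp: c_def join_coloring_def)
  finally show ?thesis by simp
qed

end
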